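(* Let $R$ and $S$ be rings and let ${}_RM_S$ be an $(R,S)$-bimodule. Then the formal triangular matrix ring $T=\left(\begin{array}{cc} R & M\\ 0 & S\end{array}\right)$ is VNL if and only if all of the following hold: (1) One of $R$ and $S$ is regular and the other is VNL. (2) Either ${}_RM$ or $M_S$ is a partial module. (3) For any non-regular element $r\in R$, $(1-r)M=M$, and for any non-regular element $s\in S$, $M(1-s)=M$.
   Context: Rings are associative with identity and modules are unital. An element $a$ of a ring $R$ is (von Neumann) regular if $a=aba$ for some $b\in R$, and non-regular otherwise; a ring is regular if all its elements are regular. A ring $R$ is VNL if for each $a\in R$, either $a$ or $1-a$ is regular in $R$. A left module ${}_RM$ is called partial if for any idempotent $e\in R$, either $eM=0$ or $(1-e)M=0$; similarly a right module $M_S$ is partial if for any idempotent $f\in S$, either $Mf=0$ or $M(1-f)=0$. The formal triangular matrix ring consists of matrices $\left(\begin{array}{cc} r & m\\ 0 & s\end{array}\right)$ with $r\in R$, $m\in M$, $s\in S$, with the usual matrix operations. *)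

theory Defs
  imports "HOL-Algebra.Module"
begin

text \<open>
  Rings are those of HOL-Algebra (associative, with identity, not necessarily commutative;
  the zero ring is allowed). The library locale \<^locale>\<open>module\<close> requires a commutative ring of
  scalars, hence the separate notions below. As for library modules, the \<open>mult\<close> and \<open>one\<close>
  fields of the record of a module carry no meaning.
\<close>

locale left_module = R?: ring R + M?: abelian_group M
  for R :: "('r, 'x) ring_scheme" and M :: "('r, 'm, 'z) module_scheme" (structure) +
  assumes smult_closed:
      "\<lbrakk>r \<in> carrier R; m \<in> carrier M\<rbrakk> \<Longrightarrow> r \<odot>\<^bsub>M\<^esub> m \<in> carrier M"
    and smult_l_distr:
      "\<lbrakk>r \<in> carrier R; r' \<in> carrier R; m \<in> carrier M\<rbrakk>
        \<Longrightarrow> (r \<oplus>\<^bsub>R\<^esub> r') \<odot>\<^bsub>M\<^esub> m = r \<odot>\<^bsub>M\<^esub> m \<oplus>\<^bsub>M\<^esub> r' \<odot>\<^bsub>M\<^esub> m"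
    and smult_r_distr:
      "\<lbrakk>r \<in> carrier R; m \<in> carrier M; n \<in> carrier M\<rbrakk>
        \<Longrightarrow> r \<odot>\<^bsub>M\<^esub> (m \<oplus>\<^bsub>M\<^esub> n) = r \<odot>\<^bsub>M\<^esub> m \<oplus>\<^bsub>M\<^esub> r \<odot>\<^bsub>M\<^esub> n"
    and smult_assoc:
      "\<lbrakk>r \<in> carrier R; r' \<in> carrier R; m \<in> carrier M\<rbrakk>
        \<Longrightarrow> (r \<otimes>\<^bsub>R\<^esub> r') \<odot>\<^bsub>M\<^esub> m = r \<odot>\<^bsub>M\<^esub> (r' \<odot>\<^bsub>M\<^esub> m)"
    and smult_one:
      "m \<in> carrier M \<Longrightarrow> \<one>\<^bsub>R\<^esub> \<odot>\<^bsub>M\<^esub> m = m"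

record ('r, 's, 'm) bimodule = "('r, 'm) module" +
  rsmult :: "['m, 's] \<Rightarrow> 'm" (infixl \<open>\<odot>\<^sub>r\<index>\<close> 70)

locale right_module = S?: ring S + M?: abelian_group M
  for S :: "('s, 'y) ring_scheme" and M :: "('r, 's, 'm, 'z) bimodule_scheme" (structure) +
  assumes rsmult_closed:
      "\<lbrakk>m \<in> carrier M; s \<in> carrier S\<rbrakk> \<Longrightarrow> m \<odot>\<^sub>r\<^bsub>M\<^esub> s \<in> carrier M"
    and rsmult_r_distr:
      "\<lbrakk>m \<in> carrier M; s \<in> carrier S; s' \<in> carrier S\<rbrakk>
        \<Longrightarrow> m \<odot>\<^sub>r\<^bsub>M\<^esub> (s \<oplus>\<^bsub>S\<^esub> s') = m \<odot>\<^sub>r\<^bsub>M\<^esub> s \<oplus>\<^bsub>M\<^esub> m \<odot>\<^sub>r\<^bsub>M\<^esub> s'"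
    and rsmult_l_distr:
      "\<lbrakk>m \<in> carrier M; n \<in> carrier M; s \<in> carrier S\<rbrakk>
        \<Longrightarrow> (m \<oplus>\<^bsub>M\<^esub> n) \<odot>\<^sub>r\<^bsub>M\<^esub> s = m \<odot>\<^sub>r\<^bsub>M\<^esub> s \<oplus>\<^bsub>M\<^esub> n \<odot>\<^sub>r\<^bsub>M\<^esub> s"
    and rsmult_assoc:
      "\<lbrakk>m \<in> carrier M; s \<in> carrier S; s' \<in> carrier S\<rbrakk>
        \<Longrightarrow> m \<odot>\<^sub>r\<^bsub>M\<^esub> (s \<otimes>\<^bsub>S\<^esub> s') = (m \<odot>\<^sub>r\<^bsub>M\<^esub> s) \<odot>\<^sub>r\<^bsub>M\<^esub> s'"
    and rsmult_one:
      "m \<in> carrier M \<Longrightarrow> m \<odot>\<^sub>r\<^bsub>M\<^esub> \<one>\<^bsub>S\<^esub> = m"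

locale bimodule = left_module R M + right_module S M
  for R :: "('r, 'x) ring_scheme" and S :: "('s, 'y) ring_scheme"
    and M :: "('r, 's, 'm, 'z) bimodule_scheme" (structure) +
  assumes smult_rsmult_assoc:
      "\<lbrakk>r \<in> carrier R; m \<in> carrier M; s \<in> carrier S\<rbrakk>
        \<Longrightarrow> (r \<odot>\<^bsub>M\<^esub> m) \<odot>\<^sub>r\<^bsub>M\<^esub> s = r \<odot>\<^bsub>M\<^esub> (m \<odot>\<^sub>r\<^bsub>M\<^esub> s)"

definition regular_elem :: "('a, 'x) ring_scheme \<Rightarrow> 'a \<Rightarrow> bool" where
  "regular_elem R a \<longleftrightarrow> (\<exists>b\<in>carrier R. a = a \<otimes>\<^bsub>R\<^esub> b \<otimes>\<^bsub>R\<^esub> a)"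

definition regular_ring :: "('a, 'x) ring_scheme \<Rightarrow> bool" where
  "regular_ring R \<longleftrightarrow> (\<forall>a\<in>carrier R. regular_elem R a)"

definition VNL_ring :: "('a, 'x) ring_scheme \<Rightarrow> bool" where
  "VNL_ring R \<longleftrightarrow> (\<forall>a\<in>carrier R. regular_elem R a \<or> regular_elem R (\<one>\<^bsub>R\<^esub> \<ominus>\<^bsub>R\<^esub> a))"

definition idempotents :: "('a, 'x) ring_scheme \<Rightarrow> 'a set" where
  "idempotents R = {e \<in> carrier R. e \<otimes>\<^bsub>R\<^esub> e = e}"

definition lset_mult ::
    "('r, 'm, 'z) module_scheme \<Rightarrow> 'r \<Rightarrow> 'm set" where
  "lset_mult M r = {r \<odot>\<^bsub>M\<^esub> m | m. m \<in> carrier M}"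

definition rset_mult ::
    "('r, 's, 'm, 'z) bimodule_scheme \<Rightarrow> 's \<Rightarrow> 'm set" where
  "rset_mult M s = {m \<odot>\<^sub>r\<^bsub>M\<^esub> s | m. m \<in> carrier M}"

definition partial_left_module ::
    "('r, 'x) ring_scheme \<Rightarrow> ('r, 'm, 'z) module_scheme \<Rightarrow> bool" where
  "partial_left_module R M \<longleftrightarrow>
    (\<forall>e\<in>idempotents R. lset_mult M e = {\<zero>\<^bsub>M\<^esub>} \<or> lset_mult M (\<one>\<^bsub>R\<^esub> \<ominus>\<^bsub>R\<^esub> e) = {\<zero>\<^bsub>M\<^esub>})"

definition partial_right_module ::
    "('s, 'y) ring_scheme \<Rightarrow> ('r, 's, 'm, 'z) bimodule_scheme \<Rightarrow> bool" where
  "partial_right_module S M \<longleftrightarrow>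
    (\<forall>f\<in>idempotents S. rset_mult M f = {\<zero>\<^bsub>M\<^esub>} \<or> rset_mult M (\<one>\<^bsub>S\<^esub> \<ominus>\<^bsub>S\<^esub> f) = {\<zero>\<^bsub>M\<^esub>})"

text \<open>
  The triple \<open>(r, m, s)\<close> stands for the upper triangular matrix with diagonal entries
  \<open>r\<close>, \<open>s\<close> and upper right entry \<open>m\<close>.
\<close>

definition tri_ring ::
    "('r, 'x) ring_scheme \<Rightarrow> ('r, 's, 'm, 'z) bimodule_scheme \<Rightarrow> ('s, 'y) ring_scheme
      \<Rightarrow> ('r \<times> 'm \<times> 's) ring" where
  "tri_ring R M S =
    \<lparr>carrier = carrier R \<times> carrier M \<times> carrier S,
     mult = (\<lambda>(r, m, s) (r', m', s').
       (r \<otimes>\<^bsub>R\<^esub> r', r \<odot>\<^bsub>M\<^esub> m' \<oplus>\<^bsub>M\<^esub> m \<odot>\<^sub>r\<^bsub>M\<^esub> s', s \<otimes>\<^bsub>S\<^esub> s')),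
     one = (\<one>\<^bsub>R\<^esub>, \<zero>\<^bsub>M\<^esub>, \<one>\<^bsub>S\<^esub>),
     zero = (\<zero>\<^bsub>R\<^esub>, \<zero>\<^bsub>M\<^esub>, \<zero>\<^bsub>S\<^esub>),
     add = (\<lambda>(r, m, s) (r', m', s').
       (r \<oplus>\<^bsub>R\<^esub> r', m \<oplus>\<^bsub>M\<^esub> m', s \<oplus>\<^bsub>S\<^esub> s'))\<rparr>"

context bimodule
begin

lemma smult_zero: "r \<in> carrier R \<Longrightarrow> r \<odot>\<^bsub>M\<^esub> \<zero>\<^bsub>M\<^esub> = \<zero>\<^bsub>M\<^esub>"
  by (metis M.add.l_cancel_one' M.add.one_closed M.add.r_one smult_closed smult_r_distr)

lemma zero_rsmult: "s \<in> carrier S \<Longrightarrow> \<zero>\<^bsub>M\<^esub> \<odot>\<^sub>r\<^bsub>M\<^esub> s = \<zero>\<^bsub>M\<^esub>"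
  by (metis M.add.l_cancel_one' M.add.one_closed M.add.r_one rsmult_closed rsmult_l_distr)

lemma tri_ring_is_ring: "ring (tri_ring R M S)"
proof (rule ringI)
  show "abelian_group (tri_ring R M S)"
  proof (rule abelian_groupI)
    fix x assume "x \<in> carrier (tri_ring R M S)"
    then obtain r m s where x: "x = (r, m, s)" "r \<in> carrier R" "m \<in> carrier M" "s \<in> carrier S"
      by (auto simp: tri_ring_def)
    show "\<exists>y\<in>carrier (tri_ring R M S). y \<oplus>\<^bsub>tri_ring R M S\<^esub> x = \<zero>\<^bsub>tri_ring R M S\<^esub>"
      using x by (intro bexI[of _ "(\<ominus>\<^bsub>R\<^esub> r, \<ominus>\<^bsub>M\<^esub> m, \<ominus>\<^bsub>S\<^esub> s)"])
        (auto simp: tri_ring_def R.l_neg M.l_neg S.l_neg)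
  qed (auto simp: tri_ring_def R.a_ac M.a_ac S.a_ac)
  show "monoid (tri_ring R M S)"
    by (rule monoidI)
      (auto simp: tri_ring_def smult_closed rsmult_closed smult_zero zero_rsmult smult_one
        rsmult_one smult_assoc rsmult_assoc smult_r_distr rsmult_l_distr smult_rsmult_assoc
        R.m_assoc S.m_assoc M.a_assoc)
qed (auto simp: tri_ring_def smult_closed rsmult_closed smult_r_distr rsmult_l_distr
    smult_l_distr rsmult_r_distr R.l_distr R.r_distr S.l_distr S.r_distr M.a_ac)

end

end

(*
  Writing x = (r, m, s), regularity of x means that r = r r' r, s = s s' s and
  m = r r' m + r m' s + m s' s for some r', m', s'. Hence a m b = 0 whenever a r = 0 and s b = 0,
  while conversely x is regular as soon as r and s are regular and m lies in rM or in Ms.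

  For idempotents e, f and the elements (e, m, f), VNL gives (1-e)m(1-f) = 0 or emf = 0 for each m.
  As M is not the union of two proper subgroups, one of (1-e)M(1-f), eMf vanishes; together with
  the same for 1-f in place of f this gives (2). If r is non-regular then so is (r, -m, 1), thus
  (1-r, m, 0) is regular, which gives (3).

  For the converse, if r, 1-r, s, 1-s are all regular and, say, the left module M is partial, put
  e = r r'. Either (1-e)M = 0 and m = r(r'm) lies in rM, or rM = erM = 0 and m = (1-r)m.
*)
theory Submission
  imports Defs
begin

context bimodule
begin

section \<open>Bimodule arithmetic: zero, negation and complementary scalars\<close>

lemma zero_smult: "m \<in> carrier M \<Longrightarrow> \<zero>\<^bsub>R\<^esub> \<odot>\<^bsub>M\<^esub> m = \<zero>\<^bsub>M\<^esub>"
  by (metis M.add.l_cancel_one' R.zero_closed R.l_zero smult_closed smult_l_distr)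

lemma rsmult_zero: "m \<in> carrier M \<Longrightarrow> m \<odot>\<^sub>r\<^bsub>M\<^esub> \<zero>\<^bsub>S\<^esub> = \<zero>\<^bsub>M\<^esub>"
  by (metis M.add.l_cancel_one' S.zero_closed S.l_zero rsmult_closed rsmult_r_distr)

lemma smult_r_minus:
  assumes "r \<in> carrier R" "m \<in> carrier M"
  shows "r \<odot>\<^bsub>M\<^esub> (\<ominus>\<^bsub>M\<^esub> m) = \<ominus>\<^bsub>M\<^esub> (r \<odot>\<^bsub>M\<^esub> m)"
proof -
  have "r \<odot>\<^bsub>M\<^esub> (\<ominus>\<^bsub>M\<^esub> m) \<oplus>\<^bsub>M\<^esub> r \<odot>\<^bsub>M\<^esub> m = \<zero>\<^bsub>M\<^esub>"
    using assms by (simp add: smult_r_distr[symmetric] M.l_neg smult_zero)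
  then show ?thesis
    using assms by (simp add: M.minus_equality smult_closed)
qed

lemma rsmult_l_minus:
  assumes "m \<in> carrier M" "s \<in> carrier S"
  shows "(\<ominus>\<^bsub>M\<^esub> m) \<odot>\<^sub>r\<^bsub>M\<^esub> s = \<ominus>\<^bsub>M\<^esub> (m \<odot>\<^sub>r\<^bsub>M\<^esub> s)"
proof -
  have "(\<ominus>\<^bsub>M\<^esub> m) \<odot>\<^sub>r\<^bsub>M\<^esub> s \<oplus>\<^bsub>M\<^esub> m \<odot>\<^sub>r\<^bsub>M\<^esub> s = \<zero>\<^bsub>M\<^esub>"
    using assms by (simp add: rsmult_l_distr[symmetric] M.l_neg zero_rsmult)
  then show ?thesis
    using assms by (simp add: M.minus_equality rsmult_closed)
qed

text \<open>The scalars \<open>r\<close> and \<open>1 - r\<close> add up to 1. Hence if one of the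
  two summands vanishes, \<open>m\<close> equals the other one, and if both vanish then
  \<open>m\<close> is zero.\<close>

lemma smult_split:
  assumes "r \<in> carrier R" "m \<in> carrier M"
  shows "r \<odot>\<^bsub>M\<^esub> m \<oplus>\<^bsub>M\<^esub> (\<one>\<^bsub>R\<^esub> \<ominus>\<^bsub>R\<^esub> r) \<odot>\<^bsub>M\<^esub> m = m"
proof -
  have "r \<oplus>\<^bsub>R\<^esub> (\<one>\<^bsub>R\<^esub> \<ominus>\<^bsub>R\<^esub> r) = \<one>\<^bsub>R\<^esub>"
    using assms by algebra
  then show ?thesis
    using assms by (simp add: smult_l_distr[symmetric] smult_one)
qed

lemma rsmult_split:
  assumes "s \<in> carrier S" "m \<in> carrier M"
  shows "m \<odot>\<^sub>r\<^bsub>M\<^esub> s \<oplus>\<^bsub>M\<^esub> m \<odot>\<^sub>r\<^bsub>M\<^esub> (\<one>\<^bsub>S\<^esub> \<ominus>\<^bsub>S\<^esub> s) = m"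
proof -
  have "s \<oplus>\<^bsub>S\<^esub> (\<one>\<^bsub>S\<^esub> \<ominus>\<^bsub>S\<^esub> s) = \<one>\<^bsub>S\<^esub>"
    using assms by algebra
  then show ?thesis
    using assms by (simp add: rsmult_r_distr[symmetric] rsmult_one)
qed

text \<open>The complement \<open>1 - (r, m, s)\<close> carries \<open>-m\<close> in its corner, so
  membership in the image of a scalar has to survive negation.\<close>

lemma lset_mult_minus:
  "r \<in> carrier R \<Longrightarrow> m \<in> lset_mult M r \<Longrightarrow> \<ominus>\<^bsub>M\<^esub> m \<in> lset_mult M r"
  by (auto simp: lset_mult_def smult_r_minus[symmetric])

lemma rset_mult_minus:
  "s \<in> carrier S \<Longrightarrow> m \<in> rset_mult M s \<Longrightarrow> \<ominus>\<^bsub>M\<^esub> m \<in> rset_mult M s"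
  by (auto simp: rset_mult_def rsmult_l_minus[symmetric])

lemma lset_mult_eq_zero_iff:
  "r \<in> carrier R \<Longrightarrow> lset_mult M r = {\<zero>\<^bsub>M\<^esub>} \<longleftrightarrow> (\<forall>m\<in>carrier M. r \<odot>\<^bsub>M\<^esub> m = \<zero>\<^bsub>M\<^esub>)"
  unfolding lset_mult_def using smult_zero[symmetric] M.zero_closed by blast

lemma rset_mult_eq_zero_iff:
  "s \<in> carrier S \<Longrightarrow> rset_mult M s = {\<zero>\<^bsub>M\<^esub>} \<longleftrightarrow> (\<forall>m\<in>carrier M. m \<odot>\<^sub>r\<^bsub>M\<^esub> s = \<zero>\<^bsub>M\<^esub>)"
  unfolding rset_mult_def using zero_rsmult[symmetric] M.zero_closed by blast

section \<open>Regular elements of the triangular ring\<close>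

lemma tri_ring_one_minus:
  assumes "r \<in> carrier R" "m \<in> carrier M" "s \<in> carrier S"
  shows "\<one>\<^bsub>tri_ring R M S\<^esub> \<ominus>\<^bsub>tri_ring R M S\<^esub> (r, m, s) =
    (\<one>\<^bsub>R\<^esub> \<ominus>\<^bsub>R\<^esub> r, \<ominus>\<^bsub>M\<^esub> m, \<one>\<^bsub>S\<^esub> \<ominus>\<^bsub>S\<^esub> s)"
proof -
  interpret T: ring "tri_ring R M S"
    by (rule tri_ring_is_ring)
  have "\<ominus>\<^bsub>tri_ring R M S\<^esub> (r, m, s) = (\<ominus>\<^bsub>R\<^esub> r, \<ominus>\<^bsub>M\<^esub> m, \<ominus>\<^bsub>S\<^esub> s)"
    by (rule T.minus_equality)
      (use assms in \<open>auto simp: tri_ring_def R.l_neg M.l_neg S.l_neg\<close>)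
  then show ?thesis
    using assms by (simp add: a_minus_def tri_ring_def)
qed

text \<open>Comparison of the three entries in \<open>x = (x x') x\<close>, where \<open>x'\<close>
  is the matrix \<open>(r', m', s')\<close>.\<close>

lemma regular_tri_iff:
  assumes "r \<in> carrier R" "m \<in> carrier M" "s \<in> carrier S"
  shows "regular_elem (tri_ring R M S) (r, m, s) \<longleftrightarrow>
    (\<exists>r'\<in>carrier R. \<exists>m'\<in>carrier M. \<exists>s'\<in>carrier S.
      r = r \<otimes>\<^bsub>R\<^esub> r' \<otimes>\<^bsub>R\<^esub> r \<and> s = s \<otimes>\<^bsub>S\<^esub> s' \<otimes>\<^bsub>S\<^esub> s \<and>
      m = (r \<otimes>\<^bsub>R\<^esub> r') \<odot>\<^bsub>M\<^esub> m \<oplus>\<^bsub>M\<^esub> (r \<odot>\<^bsub>M\<^esub> m' \<oplus>\<^bsub>M\<^esub> m \<odot>\<^sub>r\<^bsub>M\<^esub> s') \<odot>\<^sub>r\<^bsub>M\<^esub> s)"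
  by (auto simp: regular_elem_def tri_ring_def)

text \<open>Both diagonal projections are multiplicative, so they carry regular elements to regular
  elements.\<close>

lemma regular_triD:
  assumes "regular_elem (tri_ring R M S) (r, m, s)"
    and "r \<in> carrier R" "m \<in> carrier M" "s \<in> carrier S"
  shows "regular_elem R r" "regular_elem S s"
  using assms(1)[unfolded regular_tri_iff[OF assms(2-4)]] unfolding regular_elem_def by blast+

text \<open>In \<open>m = r r' m + r m' s + m s' s\<close> every summand starts with
  \<open>r\<close> or ends with \<open>s\<close>. The factor \<open>a\<close> on the left kills the
  former, the factor \<open>b\<close> on the right the latter.\<close>

lemma regular_tri_annihilate:
  assumes reg: "regular_elem (tri_ring R M S) (r, m, s)"
    and [simp]: "r \<in> carrier R" "m \<in> carrier M" "s \<in> carrier S" "a \<in> carrier R" "b \<in> carrier S"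
    and ar: "a \<otimes>\<^bsub>R\<^esub> r = \<zero>\<^bsub>R\<^esub>" and sb: "s \<otimes>\<^bsub>S\<^esub> b = \<zero>\<^bsub>S\<^esub>"
  shows "a \<odot>\<^bsub>M\<^esub> m \<odot>\<^sub>r\<^bsub>M\<^esub> b = \<zero>\<^bsub>M\<^esub>"
proof -
  from reg obtain r' m' s' where [simp]: "r' \<in> carrier R" "m' \<in> carrier M" "s' \<in> carrier S"
    and m: "m = (r \<otimes>\<^bsub>R\<^esub> r') \<odot>\<^bsub>M\<^esub> m \<oplus>\<^bsub>M\<^esub> (r \<odot>\<^bsub>M\<^esub> m' \<oplus>\<^bsub>M\<^esub> m \<odot>\<^sub>r\<^bsub>M\<^esub> s') \<odot>\<^sub>r\<^bsub>M\<^esub> s"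
    by (auto simp: regular_tri_iff)
  note [simp] = smult_closed rsmult_closed
  define n where "n = r \<odot>\<^bsub>M\<^esub> m' \<oplus>\<^bsub>M\<^esub> m \<odot>\<^sub>r\<^bsub>M\<^esub> s'"
  have n[simp]: "n \<in> carrier M"
    by (simp add: n_def)
  have "a \<odot>\<^bsub>M\<^esub> m = a \<odot>\<^bsub>M\<^esub> ((r \<otimes>\<^bsub>R\<^esub> r') \<odot>\<^bsub>M\<^esub> m) \<oplus>\<^bsub>M\<^esub> a \<odot>\<^bsub>M\<^esub> (n \<odot>\<^sub>r\<^bsub>M\<^esub> s)"
    by (subst m) (simp add: smult_r_distr n_def[symmetric])
  also have "a \<odot>\<^bsub>M\<^esub> ((r \<otimes>\<^bsub>R\<^esub> r') \<odot>\<^bsub>M\<^esub> m) = (a \<otimes>\<^bsub>R\<^esub> r) \<odot>\<^bsub>M\<^esub> (r' \<odot>\<^bsub>M\<^esub> m)"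
    by (simp add: smult_assoc)
  also have "\<dots> = \<zero>\<^bsub>M\<^esub>"
    by (simp add: ar zero_smult)
  finally have "a \<odot>\<^bsub>M\<^esub> m = a \<odot>\<^bsub>M\<^esub> n \<odot>\<^sub>r\<^bsub>M\<^esub> s"
    by (simp add: smult_rsmult_assoc)
  then have "a \<odot>\<^bsub>M\<^esub> m \<odot>\<^sub>r\<^bsub>M\<^esub> b = a \<odot>\<^bsub>M\<^esub> n \<odot>\<^sub>r\<^bsub>M\<^esub> (s \<otimes>\<^bsub>S\<^esub> b)"
    by (simp add: rsmult_assoc)
  then show ?thesis
    by (simp add: sb rsmult_zero)
qed

text \<open>With lower right entry 0 all summands ending in that entry vanish, which leaves
  \<open>m = r r' m\<close>.\<close>

lemma regular_tri_lset:
  assumes "regular_elem (tri_ring R M S) (r, m, \<zero>\<^bsub>S\<^esub>)" "r \<in> carrier R" "m \<in> carrier M"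
  shows "m \<in> lset_mult M r"
proof -
  obtain r' where r': "r' \<in> carrier R" and m: "m = (r \<otimes>\<^bsub>R\<^esub> r') \<odot>\<^bsub>M\<^esub> m"
    using assms by (auto simp: regular_tri_iff rsmult_zero smult_closed rsmult_closed)
  have "m = r \<odot>\<^bsub>M\<^esub> (r' \<odot>\<^bsub>M\<^esub> m)"
    using assms r' m by (simp add: smult_assoc)
  then show ?thesis
    using assms r' by (auto simp: lset_mult_def intro!: smult_closed)
qed

lemma regular_tri_rset:
  assumes "regular_elem (tri_ring R M S) (\<zero>\<^bsub>R\<^esub>, m, s)" "m \<in> carrier M" "s \<in> carrier S"
  shows "m \<in> rset_mult M s"
proof -
  obtain s' where s': "s' \<in> carrier S" and m: "m = m \<odot>\<^sub>r\<^bsub>M\<^esub> s' \<odot>\<^sub>r\<^bsub>M\<^esub> s"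
    using assms by (auto simp: regular_tri_iff zero_smult smult_closed rsmult_closed)
  then show ?thesis
    using assms s' by (auto simp: rset_mult_def intro!: rsmult_closed)
qed

lemma regular_triI_lset:
  assumes "regular_elem R r" "regular_elem S s" "m \<in> lset_mult M r"
    and [simp]: "r \<in> carrier R" "s \<in> carrier S"
  shows "regular_elem (tri_ring R M S) (r, m, s)"
proof -
  note [simp] = smult_closed rsmult_closed
  obtain r' where [simp]: "r' \<in> carrier R" and r: "r = r \<otimes>\<^bsub>R\<^esub> r' \<otimes>\<^bsub>R\<^esub> r"
    using assms by (auto simp: regular_elem_def)
  obtain s' where [simp]: "s' \<in> carrier S" and s: "s = s \<otimes>\<^bsub>S\<^esub> s' \<otimes>\<^bsub>S\<^esub> s"
    using assms by (auto simp: regular_elem_def)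
  obtain n where [simp]: "n \<in> carrier M" and m: "m = r \<odot>\<^bsub>M\<^esub> n"
    using assms by (auto simp: lset_mult_def)
  have [simp]: "m \<in> carrier M"
    by (simp add: m)
  have e: "(r \<otimes>\<^bsub>R\<^esub> r') \<odot>\<^bsub>M\<^esub> m = m"
    using r by (simp add: m smult_assoc[symmetric])
  \<comment> \<open>This choice makes the bracket \<open>r m' + m s'\<close> vanish, because
    \<open>m s' = r n s'\<close>. Only \<open>r r' m = m\<close> remains.\<close>
  define m' where "m' = \<ominus>\<^bsub>M\<^esub> (n \<odot>\<^sub>r\<^bsub>M\<^esub> s')"
  have [simp]: "m' \<in> carrier M"
    by (simp add: m'_def)
  have "r \<odot>\<^bsub>M\<^esub> m' \<oplus>\<^bsub>M\<^esub> m \<odot>\<^sub>r\<^bsub>M\<^esub> s' = \<zero>\<^bsub>M\<^esub>"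
    by (simp add: m m'_def smult_r_minus smult_rsmult_assoc M.l_neg)
  then have "m = (r \<otimes>\<^bsub>R\<^esub> r') \<odot>\<^bsub>M\<^esub> m \<oplus>\<^bsub>M\<^esub> (r \<odot>\<^bsub>M\<^esub> m' \<oplus>\<^bsub>M\<^esub> m \<odot>\<^sub>r\<^bsub>M\<^esub> s') \<odot>\<^sub>r\<^bsub>M\<^esub> s"
    by (simp add: e zero_rsmult)
  then show ?thesis
    using r s by (subst regular_tri_iff)
      (auto intro!: bexI[of _ r'] bexI[of _ m'] bexI[of _ s'])
qed

lemma regular_triI_rset:
  assumes "regular_elem R r" "regular_elem S s" "m \<in> rset_mult M s"
    and [simp]: "r \<in> carrier R" "s \<in> carrier S"
  shows "regular_elem (tri_ring R M S) (r, m, s)"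
proof -
  note [simp] = smult_closed rsmult_closed
  obtain r' where [simp]: "r' \<in> carrier R" and r: "r = r \<otimes>\<^bsub>R\<^esub> r' \<otimes>\<^bsub>R\<^esub> r"
    using assms by (auto simp: regular_elem_def)
  obtain s' where [simp]: "s' \<in> carrier S" and s: "s = s \<otimes>\<^bsub>S\<^esub> s' \<otimes>\<^bsub>S\<^esub> s"
    using assms by (auto simp: regular_elem_def)
  obtain n where [simp]: "n \<in> carrier M" and m: "m = n \<odot>\<^sub>r\<^bsub>M\<^esub> s"
    using assms by (auto simp: rset_mult_def)
  have [simp]: "m \<in> carrier M"
    by (simp add: m)
  have f: "m \<odot>\<^sub>r\<^bsub>M\<^esub> s' \<odot>\<^sub>r\<^bsub>M\<^esub> s = m"
    using s by (simp add: m rsmult_assoc[symmetric] S.m_assoc)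
  \<comment> \<open>Here \<open>r m' s = - r r' n s = - r r' m\<close> cancels the first summand
    instead, and \<open>m s' s = m\<close> remains.\<close>
  define m' where "m' = \<ominus>\<^bsub>M\<^esub> (r' \<odot>\<^bsub>M\<^esub> n)"
  have [simp]: "m' \<in> carrier M"
    by (simp add: m'_def)
  have "(r \<otimes>\<^bsub>R\<^esub> r') \<odot>\<^bsub>M\<^esub> m = r \<odot>\<^bsub>M\<^esub> (r' \<odot>\<^bsub>M\<^esub> n) \<odot>\<^sub>r\<^bsub>M\<^esub> s"
    by (simp add: m smult_assoc smult_rsmult_assoc)
  then have "(r \<otimes>\<^bsub>R\<^esub> r') \<odot>\<^bsub>M\<^esub> m \<oplus>\<^bsub>M\<^esub> r \<odot>\<^bsub>M\<^esub> m' \<odot>\<^sub>r\<^bsub>M\<^esub> s = \<zero>\<^bsub>M\<^esub>"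
    by (simp add: m'_def smult_r_minus rsmult_l_minus M.r_neg)
  then have "m = (r \<otimes>\<^bsub>R\<^esub> r') \<odot>\<^bsub>M\<^esub> m \<oplus>\<^bsub>M\<^esub> (r \<odot>\<^bsub>M\<^esub> m' \<oplus>\<^bsub>M\<^esub> m \<odot>\<^sub>r\<^bsub>M\<^esub> s') \<odot>\<^sub>r\<^bsub>M\<^esub> s"
    by (simp add: rsmult_l_distr f M.a_assoc[symmetric])
  then show ?thesis
    using r s by (subst regular_tri_iff)
      (auto intro!: bexI[of _ r'] bexI[of _ m'] bexI[of _ s'])
qed

section \<open>Necessity of the three conditions\<close>

lemma VNL_triD:
  assumes "VNL_ring (tri_ring R M S)" "r \<in> carrier R" "m \<in> carrier M" "s \<in> carrier S"
  shows "regular_elem (tri_ring R M S) (r, m, s) \<or>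
    regular_elem (tri_ring R M S) (\<one>\<^bsub>R\<^esub> \<ominus>\<^bsub>R\<^esub> r, \<ominus>\<^bsub>M\<^esub> m, \<one>\<^bsub>S\<^esub> \<ominus>\<^bsub>S\<^esub> s)"
proof -
  have "(r, m, s) \<in> carrier (tri_ring R M S)"
    using assms by (simp add: tri_ring_def)
  then show ?thesis
    using assms unfolding VNL_ring_def by (metis tri_ring_one_minus)
qed

text \<open>One alternative serves both diagonal entries at once. This coupling is stronger than VNL
  for \<open>R\<close> and \<open>S\<close> separately, and it is what forces one of them to be
  regular.\<close>

lemma VNL_tri_diagonal:
  assumes "VNL_ring (tri_ring R M S)" "r \<in> carrier R" "s \<in> carrier S"
  shows "regular_elem R r \<and> regular_elem S s \<or>
    regular_elem R (\<one>\<^bsub>R\<^esub> \<ominus>\<^bsub>R\<^esub> r) \<and> regular_elem S (\<one>\<^bsub>S\<^esub> \<ominus>\<^bsub>S\<^esub> s)"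
  using VNL_triD[OF assms(1,2) M.zero_closed assms(3)] assms(2,3)
  by (auto dest: regular_triD)

lemma VNL_tri_components:
  assumes VNL: "VNL_ring (tri_ring R M S)"
  shows "(regular_ring R \<and> VNL_ring S) \<or> (regular_ring S \<and> VNL_ring R)"
proof -
  have "VNL_ring R" "VNL_ring S"
    using VNL_tri_diagonal[OF VNL] unfolding VNL_ring_def by blast+
  moreover have "regular_ring R \<or> regular_ring S"
  proof (rule ccontr)
    assume "\<not> ?thesis"
    then obtain r s where r: "r \<in> carrier R" "\<not> regular_elem R r"
      and s: "s \<in> carrier S" "\<not> regular_elem S s"
      by (auto simp: regular_ring_def)
    have "\<one>\<^bsub>S\<^esub> \<ominus>\<^bsub>S\<^esub> (\<one>\<^bsub>S\<^esub> \<ominus>\<^bsub>S\<^esub> s) = s"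
      using s(1) by algebra
    \<comment> \<open>The matrix with diagonal \<open>r\<close>, \<open>1 - s\<close> fails at
      \<open>r\<close>, while its complement, with diagonal \<open>1 - r\<close>, \<open>s\<close>,
      fails at \<open>s\<close>.\<close>
    then show False
      using VNL_tri_diagonal[OF VNL r(1), of "\<one>\<^bsub>S\<^esub> \<ominus>\<^bsub>S\<^esub> s"] r s by auto
  qed
  ultimately show ?thesis
    by blast
qed

lemma VNL_tri_lset:
  assumes VNL: "VNL_ring (tri_ring R M S)" and r: "r \<in> carrier R" "\<not> regular_elem R r"
  shows "lset_mult M (\<one>\<^bsub>R\<^esub> \<ominus>\<^bsub>R\<^esub> r) = carrier M"
proof
  show "lset_mult M (\<one>\<^bsub>R\<^esub> \<ominus>\<^bsub>R\<^esub> r) \<subseteq> carrier M"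
    using r by (auto simp: lset_mult_def smult_closed)
  show "carrier M \<subseteq> lset_mult M (\<one>\<^bsub>R\<^esub> \<ominus>\<^bsub>R\<^esub> r)"
  proof
    fix m assume m: "m \<in> carrier M"
    have "\<one>\<^bsub>S\<^esub> \<ominus>\<^bsub>S\<^esub> \<one>\<^bsub>S\<^esub> = \<zero>\<^bsub>S\<^esub>"
      by algebra
    then have "regular_elem (tri_ring R M S) (\<one>\<^bsub>R\<^esub> \<ominus>\<^bsub>R\<^esub> r, m, \<zero>\<^bsub>S\<^esub>)"
      using VNL_triD[OF VNL r(1), of "\<ominus>\<^bsub>M\<^esub> m" "\<one>\<^bsub>S\<^esub>"] m r by (auto dest: regular_triD)
    then show "m \<in> lset_mult M (\<one>\<^bsub>R\<^esub> \<ominus>\<^bsub>R\<^esub> r)"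
      using m r by (simp add: regular_tri_lset)
  qed
qed

text \<open>The mirrored test matrix is \<open>(1, -m, s)\<close>: it is non-regular because of
  \<open>s\<close>, so its complement \<open>(0, m, 1 - s)\<close> is regular.\<close>

lemma VNL_tri_rset:
  assumes VNL: "VNL_ring (tri_ring R M S)" and s: "s \<in> carrier S" "\<not> regular_elem S s"
  shows "rset_mult M (\<one>\<^bsub>S\<^esub> \<ominus>\<^bsub>S\<^esub> s) = carrier M"
proof
  show "rset_mult M (\<one>\<^bsub>S\<^esub> \<ominus>\<^bsub>S\<^esub> s) \<subseteq> carrier M"
    using s by (auto simp: rset_mult_def rsmult_closed)
  show "carrier M \<subseteq> rset_mult M (\<one>\<^bsub>S\<^esub> \<ominus>\<^bsub>S\<^esub> s)"
  proof
    fix m assume m: "m \<in> carrier M"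
    have "\<one>\<^bsub>R\<^esub> \<ominus>\<^bsub>R\<^esub> \<one>\<^bsub>R\<^esub> = \<zero>\<^bsub>R\<^esub>"
      by algebra
    then have "regular_elem (tri_ring R M S) (\<zero>\<^bsub>R\<^esub>, m, \<one>\<^bsub>S\<^esub> \<ominus>\<^bsub>S\<^esub> s)"
      using VNL_triD[OF VNL R.one_closed _ s(1), of "\<ominus>\<^bsub>M\<^esub> m"] m s by (auto dest: regular_triD)
    then show "m \<in> rset_mult M (\<one>\<^bsub>S\<^esub> \<ominus>\<^bsub>S\<^esub> s)"
      using m s by (simp add: regular_tri_rset)
  qed
qed

lemma VNL_tri_corner:
  assumes VNL: "VNL_ring (tri_ring R M S)"
    and e: "e \<in> idempotents R" and f: "f \<in> idempotents S"
  shows "(\<forall>m\<in>carrier M. (\<one>\<^bsub>R\<^esub> \<ominus>\<^bsub>R\<^esub> e) \<odot>\<^bsub>M\<^esub> m \<odot>\<^sub>r\<^bsub>M\<^esub> (\<one>\<^bsub>S\<^esub> \<ominus>\<^bsub>S\<^esub> f) = \<zero>\<^bsub>M\<^esub>) \<or>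
    (\<forall>m\<in>carrier M. e \<odot>\<^bsub>M\<^esub> m \<odot>\<^sub>r\<^bsub>M\<^esub> f = \<zero>\<^bsub>M\<^esub>)"
proof -
  let ?e = "\<one>\<^bsub>R\<^esub> \<ominus>\<^bsub>R\<^esub> e" and ?f = "\<one>\<^bsub>S\<^esub> \<ominus>\<^bsub>S\<^esub> f"
  have e': "e \<in> carrier R" "e \<otimes>\<^bsub>R\<^esub> e = e" and f': "f \<in> carrier S" "f \<otimes>\<^bsub>S\<^esub> f = f"
    using e f by (auto simp: idempotents_def)
  note [simp] = e' f' smult_closed rsmult_closed
  have [simp]: "?e \<otimes>\<^bsub>R\<^esub> e = \<zero>\<^bsub>R\<^esub>" "e \<otimes>\<^bsub>R\<^esub> ?e = \<zero>\<^bsub>R\<^esub>" "f \<otimes>\<^bsub>S\<^esub> ?f = \<zero>\<^bsub>S\<^esub>" "?f \<otimes>\<^bsub>S\<^esub> f = \<zero>\<^bsub>S\<^esub>"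
    by (simp_all add: a_minus_def R.l_distr R.r_distr S.l_distr S.r_distr
        R.l_minus R.r_minus S.l_minus S.r_minus R.r_neg S.r_neg)
  \<comment> \<open>If \<open>(e, m, f)\<close> is regular, its annihilators \<open>1 - e\<close> on
    the left and \<open>1 - f\<close> on the right apply; if its complement is regular,
    \<open>e\<close> and \<open>f\<close> do.\<close>
  have dich: "?e \<odot>\<^bsub>M\<^esub> m \<odot>\<^sub>r\<^bsub>M\<^esub> ?f = \<zero>\<^bsub>M\<^esub> \<or> e \<odot>\<^bsub>M\<^esub> m \<odot>\<^sub>r\<^bsub>M\<^esub> f = \<zero>\<^bsub>M\<^esub>" if m: "m \<in> carrier M" for m
    using VNL_triD[OF VNL e'(1) m f'(1)]
  proof
    assume "regular_elem (tri_ring R M S) (e, m, f)"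
    then show ?thesis
      using m by (simp add: regular_tri_annihilate)
  next
    assume "regular_elem (tri_ring R M S) (?e, \<ominus>\<^bsub>M\<^esub> m, ?f)"
    then have "e \<odot>\<^bsub>M\<^esub> (\<ominus>\<^bsub>M\<^esub> m) \<odot>\<^sub>r\<^bsub>M\<^esub> f = \<zero>\<^bsub>M\<^esub>"
      by (rule regular_tri_annihilate) (use m in simp_all)
    then show ?thesis
      using m by (simp add: smult_r_minus rsmult_l_minus)
  qed
  show ?thesis
  proof (rule ccontr)
    assume "\<not> ?thesis"
    then obtain m n where m: "m \<in> carrier M" "?e \<odot>\<^bsub>M\<^esub> m \<odot>\<^sub>r\<^bsub>M\<^esub> ?f \<noteq> \<zero>\<^bsub>M\<^esub>"
      and n: "n \<in> carrier M" "e \<odot>\<^bsub>M\<^esub> n \<odot>\<^sub>r\<^bsub>M\<^esub> f \<noteq> \<zero>\<^bsub>M\<^esub>"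
      by blast
    then have "e \<odot>\<^bsub>M\<^esub> m \<odot>\<^sub>r\<^bsub>M\<^esub> f = \<zero>\<^bsub>M\<^esub>" "?e \<odot>\<^bsub>M\<^esub> n \<odot>\<^sub>r\<^bsub>M\<^esub> ?f = \<zero>\<^bsub>M\<^esub>"
      using dich by blast+
    \<comment> \<open>Each of \<open>m\<close> and \<open>n\<close> lies in exactly one of the two
      kernels, and not in the same one, so \<open>m + n\<close> lies in neither.\<close>
    then show False
      using dich[of "m \<oplus>\<^bsub>M\<^esub> n"] m n by (simp add: smult_r_distr rsmult_l_distr)
  qed
qed

lemma VNL_tri_partial:
  assumes VNL: "VNL_ring (tri_ring R M S)"
  shows "partial_left_module R M \<or> partial_right_module S M"
proof (rule ccontr)
  assume "\<not> ?thesis"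
  then obtain e f where e: "e \<in> idempotents R" and f: "f \<in> idempotents S"
    and ne: "lset_mult M e \<noteq> {\<zero>\<^bsub>M\<^esub>}" "lset_mult M (\<one>\<^bsub>R\<^esub> \<ominus>\<^bsub>R\<^esub> e) \<noteq> {\<zero>\<^bsub>M\<^esub>}"
      "rset_mult M f \<noteq> {\<zero>\<^bsub>M\<^esub>}" "rset_mult M (\<one>\<^bsub>S\<^esub> \<ominus>\<^bsub>S\<^esub> f) \<noteq> {\<zero>\<^bsub>M\<^esub>}"
    by (auto simp: partial_left_module_def partial_right_module_def)
  let ?e = "\<one>\<^bsub>R\<^esub> \<ominus>\<^bsub>R\<^esub> e" and ?f = "\<one>\<^bsub>S\<^esub> \<ominus>\<^bsub>S\<^esub> f"
  have [simp]: "e \<in> carrier R" "f \<in> carrier S" and ff: "f \<otimes>\<^bsub>S\<^esub> f = f"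
    using e f by (auto simp: idempotents_def)
  \<comment> \<open>Replacing \<open>f\<close> by \<open>1 - f\<close> turns the dichotomy for the
    corners \<open>(1-e)M(1-f)\<close>, \<open>eMf\<close> into one for \<open>(1-e)Mf\<close>,
    \<open>eM(1-f)\<close>.\<close>
  have ff': "\<one>\<^bsub>S\<^esub> \<ominus>\<^bsub>S\<^esub> ?f = f"
    by (simp add: a_minus_def S.minus_add S.r_neg2)
  have "?f \<otimes>\<^bsub>S\<^esub> ?f = ?f"
    by (simp add: a_minus_def S.l_distr S.r_distr S.l_minus S.r_minus ff S.r_neg S.minus_add)
  then have f': "?f \<in> idempotents S"
    by (simp add: idempotents_def)
  \<comment> \<open>Two vanishing corners with the same left factor \<open>r\<close> give
    \<open>rM = 0\<close>, since \<open>r m\<close> is the sum of \<open>r m f\<close> and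
    \<open>r m (1-f)\<close>.\<close>
  have left: "lset_mult M r = {\<zero>\<^bsub>M\<^esub>}"
    if r: "r \<in> carrier R" and ann: "\<forall>m\<in>carrier M. r \<odot>\<^bsub>M\<^esub> m \<odot>\<^sub>r\<^bsub>M\<^esub> f = \<zero>\<^bsub>M\<^esub>"
      "\<forall>m\<in>carrier M. r \<odot>\<^bsub>M\<^esub> m \<odot>\<^sub>r\<^bsub>M\<^esub> ?f = \<zero>\<^bsub>M\<^esub>" for r
  proof -
    have "r \<odot>\<^bsub>M\<^esub> m = \<zero>\<^bsub>M\<^esub>" if "m \<in> carrier M" for m
      using rsmult_split[of f "r \<odot>\<^bsub>M\<^esub> m"] that ann r
      by (simp add: smult_closed)
    then show ?thesis
      using r by (simp add: lset_mult_eq_zero_iff)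
  qed
  have right: "rset_mult M s = {\<zero>\<^bsub>M\<^esub>}"
    if s: "s \<in> carrier S" and ann: "\<forall>m\<in>carrier M. e \<odot>\<^bsub>M\<^esub> m \<odot>\<^sub>r\<^bsub>M\<^esub> s = \<zero>\<^bsub>M\<^esub>"
      "\<forall>m\<in>carrier M. ?e \<odot>\<^bsub>M\<^esub> m \<odot>\<^sub>r\<^bsub>M\<^esub> s = \<zero>\<^bsub>M\<^esub>" for s
  proof -
    have "m \<odot>\<^sub>r\<^bsub>M\<^esub> s = \<zero>\<^bsub>M\<^esub>" if "m \<in> carrier M" for m
      using smult_split[of e "m \<odot>\<^sub>r\<^bsub>M\<^esub> s"] that ann s
      by (simp add: rsmult_closed smult_rsmult_assoc[symmetric])
    then show ?thesis
      using s by (simp add: rset_mult_eq_zero_iff)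
  qed
  \<comment> \<open>Of the pair \<open>(1-e)M(1-f)\<close>, \<open>eMf\<close> one corner vanishes,
    and likewise of the pair \<open>(1-e)Mf\<close>, \<open>eM(1-f)\<close>. In each of the four
    combinations the two vanishing corners share a left or a right factor, and this factor then
    annihilates \<open>M\<close>.\<close>
  show False
    using VNL_tri_corner[OF VNL e f] VNL_tri_corner[OF VNL e f', unfolded ff']
      left[of e] left[of ?e] right[of f] right[of ?f] ne
    by auto
qed

section \<open>Sufficiency of the three conditions\<close>

lemma partial_left_lset:
  assumes part: "partial_left_module R M" and reg: "regular_elem R r"
    and [simp]: "r \<in> carrier R" and m[simp]: "m \<in> carrier M"
  shows "m \<in> lset_mult M r \<or> m \<in> lset_mult M (\<one>\<^bsub>R\<^esub> \<ominus>\<^bsub>R\<^esub> r)"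
proof -
  note [simp] = smult_closed
  obtain r' where [simp]: "r' \<in> carrier R" and r: "r = r \<otimes>\<^bsub>R\<^esub> r' \<otimes>\<^bsub>R\<^esub> r"
    using reg by (auto simp: regular_elem_def)
  let ?e = "r \<otimes>\<^bsub>R\<^esub> r'"
  have "?e \<otimes>\<^bsub>R\<^esub> ?e = ?e"
    using r by (simp add: R.m_assoc[symmetric])
  then have "?e \<in> idempotents R"
    by (simp add: idempotents_def)
  with part consider (zero) "\<forall>m\<in>carrier M. ?e \<odot>\<^bsub>M\<^esub> m = \<zero>\<^bsub>M\<^esub>"
    | (one) "\<forall>m\<in>carrier M. (\<one>\<^bsub>R\<^esub> \<ominus>\<^bsub>R\<^esub> ?e) \<odot>\<^bsub>M\<^esub> m = \<zero>\<^bsub>M\<^esub>"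
    by (auto simp: partial_left_module_def lset_mult_eq_zero_iff)
  then show ?thesis
  proof cases
    \<comment> \<open>Since \<open>r r' r = r\<close>, the idempotent fixes \<open>r m\<close>; it
      also annihilates \<open>M\<close>, so \<open>r m = 0\<close>.\<close>
    case zero
    have "r \<odot>\<^bsub>M\<^esub> m = ?e \<odot>\<^bsub>M\<^esub> (r \<odot>\<^bsub>M\<^esub> m)"
      using r by (simp add: smult_assoc[symmetric])
    then have "r \<odot>\<^bsub>M\<^esub> m = \<zero>\<^bsub>M\<^esub>"
      using zero by simp
    then have "m = (\<one>\<^bsub>R\<^esub> \<ominus>\<^bsub>R\<^esub> r) \<odot>\<^bsub>M\<^esub> m"
      using smult_split[of r m] by simp
    then show ?thesis
      using m unfolding lset_mult_def by blast
  next
    case one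
    then have "m = r \<odot>\<^bsub>M\<^esub> (r' \<odot>\<^bsub>M\<^esub> m)"
      using smult_split[of ?e m] by (simp add: smult_assoc)
    moreover have "r' \<odot>\<^bsub>M\<^esub> m \<in> carrier M"
      by simp
    ultimately show ?thesis
      unfolding lset_mult_def by blast
  qed
qed

lemma partial_right_rset:
  assumes part: "partial_right_module S M" and reg: "regular_elem S s"
    and [simp]: "s \<in> carrier S" and m[simp]: "m \<in> carrier M"
  shows "m \<in> rset_mult M s \<or> m \<in> rset_mult M (\<one>\<^bsub>S\<^esub> \<ominus>\<^bsub>S\<^esub> s)"
proof -
  note [simp] = rsmult_closed
  obtain s' where [simp]: "s' \<in> carrier S" and s: "s = s \<otimes>\<^bsub>S\<^esub> s' \<otimes>\<^bsub>S\<^esub> s"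
    using reg by (auto simp: regular_elem_def)
  \<comment> \<open>On the right the order of the factors is reversed: the idempotent has to satisfy
    \<open>s f = s\<close>, and \<open>M f\<close> has to lie in \<open>M s\<close>.\<close>
  let ?f = "s' \<otimes>\<^bsub>S\<^esub> s"
  have s2: "s \<otimes>\<^bsub>S\<^esub> ?f = s"
    using s by (simp add: S.m_assoc)
  then have "?f \<otimes>\<^bsub>S\<^esub> ?f = ?f"
    by (simp add: S.m_assoc)
  then have "?f \<in> idempotents S"
    by (simp add: idempotents_def)
  with part consider (zero) "\<forall>m\<in>carrier M. m \<odot>\<^sub>r\<^bsub>M\<^esub> ?f = \<zero>\<^bsub>M\<^esub>"
    | (one) "\<forall>m\<in>carrier M. m \<odot>\<^sub>r\<^bsub>M\<^esub> (\<one>\<^bsub>S\<^esub> \<ominus>\<^bsub>S\<^esub> ?f) = \<zero>\<^bsub>M\<^esub>"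
    by (auto simp: partial_right_module_def rset_mult_eq_zero_iff)
  then show ?thesis
  proof cases
    case zero
    have "m \<odot>\<^sub>r\<^bsub>M\<^esub> s = m \<odot>\<^sub>r\<^bsub>M\<^esub> s \<odot>\<^sub>r\<^bsub>M\<^esub> ?f"
      using s2 rsmult_assoc[of m s ?f] by simp
    then have "m \<odot>\<^sub>r\<^bsub>M\<^esub> s = \<zero>\<^bsub>M\<^esub>"
      using zero by simp
    then have "m = m \<odot>\<^sub>r\<^bsub>M\<^esub> (\<one>\<^bsub>S\<^esub> \<ominus>\<^bsub>S\<^esub> s)"
      using rsmult_split[of s m] by simp
    then show ?thesis
      using m unfolding rset_mult_def by blast
  next
    case one
    then have "m = m \<odot>\<^sub>r\<^bsub>M\<^esub> s' \<odot>\<^sub>r\<^bsub>M\<^esub> s"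
      using rsmult_split[of ?f m] by (simp add: rsmult_assoc)
    moreover have "m \<odot>\<^sub>r\<^bsub>M\<^esub> s' \<in> carrier M"
      by simp
    ultimately show ?thesis
      unfolding rset_mult_def by blast
  qed
qed

text \<open>Case split on which of \<open>r\<close>, \<open>1 - r\<close>, \<open>s\<close>,
  \<open>1 - s\<close> is non-regular. Such an entry rules out one of \<open>x\<close>,
  \<open>1 - x\<close>; the diagonal of the other is then regular, and the image condition covers
  its corner. If all four are regular, partiality decides which of the two matrices is
  regular.\<close>

lemma VNL_triI:
  assumes comp: "(regular_ring R \<and> VNL_ring S) \<or> (regular_ring S \<and> VNL_ring R)"
    and part: "partial_left_module R M \<or> partial_right_module S M"
    and lset: "\<And>r. r \<in> carrier R \<Longrightarrow> \<not> regular_elem R r \<Longrightarrow>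
      lset_mult M (\<one>\<^bsub>R\<^esub> \<ominus>\<^bsub>R\<^esub> r) = carrier M"
    and rset: "\<And>s. s \<in> carrier S \<Longrightarrow> \<not> regular_elem S s \<Longrightarrow>
      rset_mult M (\<one>\<^bsub>S\<^esub> \<ominus>\<^bsub>S\<^esub> s) = carrier M"
  shows "VNL_ring (tri_ring R M S)"
  unfolding VNL_ring_def
proof
  fix x assume "x \<in> carrier (tri_ring R M S)"
  then obtain r m s where x: "x = (r, m, s)"
    and r[simp]: "r \<in> carrier R" and m[simp]: "m \<in> carrier M" and s[simp]: "s \<in> carrier S"
    by (auto simp: tri_ring_def)
  let ?r = "\<one>\<^bsub>R\<^esub> \<ominus>\<^bsub>R\<^esub> r" and ?s = "\<one>\<^bsub>S\<^esub> \<ominus>\<^bsub>S\<^esub> s"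
  have rr: "\<one>\<^bsub>R\<^esub> \<ominus>\<^bsub>R\<^esub> ?r = r" and ss: "\<one>\<^bsub>S\<^esub> \<ominus>\<^bsub>S\<^esub> ?s = s"
    by (simp_all add: a_minus_def R.minus_add S.minus_add R.r_neg2 S.r_neg2)
  let ?T = "tri_ring R M S"
  have regular: "regular_elem ?T x"
    if "regular_elem R r" "regular_elem S s" "m \<in> lset_mult M r \<or> m \<in> rset_mult M s"
    using that by (auto simp: x regular_triI_lset regular_triI_rset)
  have co_regular: "regular_elem ?T (\<one>\<^bsub>?T\<^esub> \<ominus>\<^bsub>?T\<^esub> x)"
    if "regular_elem R ?r" "regular_elem S ?s" "m \<in> lset_mult M ?r \<or> m \<in> rset_mult M ?s"
    using that
    by (auto simp: x tri_ring_one_minus lset_mult_minus rset_mult_minus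
        intro: regular_triI_lset regular_triI_rset)
  \<comment> \<open>Whichever ring is regular supplies two regular elements, so a non-regular entry
    on one side leaves both \<open>s\<close>, \<open>1 - s\<close> or both \<open>r\<close>,
    \<open>1 - r\<close> regular on the other.\<close>
  have VNL: "regular_elem R r \<or> regular_elem R ?r" "regular_elem S s \<or> regular_elem S ?s"
    and comp': "regular_elem R r \<and> regular_elem R ?r \<or> regular_elem S s \<and> regular_elem S ?s"
    using comp by (auto simp: regular_ring_def VNL_ring_def)
  consider "\<not> regular_elem R r" | "\<not> regular_elem R ?r" | "\<not> regular_elem S s"
    | "\<not> regular_elem S ?s"
    | "regular_elem R r" "regular_elem R ?r" "regular_elem S s" "regular_elem S ?s"
    by blast
  then show "regular_elem ?T x \<or> regular_elem ?T (\<one>\<^bsub>?T\<^esub> \<ominus>\<^bsub>?T\<^esub> x)"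
  proof cases
    case 1
    then show ?thesis using co_regular VNL comp' lset[of r] by simp
  next
    \<comment> \<open>The image condition is applied to \<open>1 - r\<close>, whose complement is
      \<open>r\<close>: it gives \<open>rM = M\<close>, so \<open>x\<close> itself is
      regular.\<close>
    case 2
    then show ?thesis using regular VNL comp' lset[of ?r] rr by simp
  next
    case 3
    then show ?thesis using co_regular VNL comp' rset[of s] by simp
  next
    case 4
    then show ?thesis using regular VNL comp' rset[of ?s] ss by simp
  next
    case 5
    then show ?thesis
      using part regular co_regular partial_left_lset[of r m] partial_right_rset[of s m] by auto
  qed
qed

end

theorem theorem2p12:
  fixes R :: "('r, 'x) ring_scheme" and S :: "('s, 'y) ring_scheme"
    and M :: "('r, 's, 'm, 'z) bimodule_scheme"
  assumes "bimodule R S M"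
  shows "VNL_ring (tri_ring R M S) \<longleftrightarrow>
    ((regular_ring R \<and> VNL_ring S) \<or> (regular_ring S \<and> VNL_ring R)) \<and>
    (partial_left_module R M \<or> partial_right_module S M) \<and>
    (\<forall>r\<in>carrier R. \<not> regular_elem R r \<longrightarrow>
      lset_mult M (\<one>\<^bsub>R\<^esub> \<ominus>\<^bsub>R\<^esub> r) = carrier M) \<and>
    (\<forall>s\<in>carrier S. \<not> regular_elem S s \<longrightarrow>
      rset_mult M (\<one>\<^bsub>S\<^esub> \<ominus>\<^bsub>S\<^esub> s) = carrier M)"
proof -
  interpret bimodule R S M
    by (rule assms)
  show ?thesis
    using VNL_tri_components VNL_tri_partial VNL_tri_lset VNL_tri_rset VNL_triI by blast
qed

end
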